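(* A classifier $f:\mathcal{X}\to\{0,1\}$ is truthful if and only if there exist a collection of classifiers $\mathcal{C}=\{f_j\}$ and corresponding subsets of features $\{F_j\}\subseteq 2^{F}$ such that each $f_j$ is an $F_j$-classifier and $f=\textsc{Max}_{\mathcal{C}}$, i.e. $f(x)=\max_j f_j(x)$ for all $x\in\mathcal{X}$.
   Context: There are $k$ features, indexed by $F=[k]=\{1,\dots,k\}$. Each data point $x$ in the input space $\mathcal{X}$ has for each $i\in[k]$ a feature value $x_i$, where $x_i=*$ means that $x$ does not have feature $i$; a data point is determined by its feature values. For $S\subseteq[k]$, $x|_S$ is defined by $(x|_S)_i=x_i$ if $i\in S$ and $(x|_S)_i=*$ otherwise; $\mathcal{X}$ is closed under $x\mapsto x|_S$ for every $S\subseteq[k]$. For $x,x'\in\mathcal{X}$ write $x\to x'$ if there is $S\subseteq[k]$ with $x|_S=x'$. A classifier is a function $f:\mathcal{X}\to\{0,1\}$. A classifier $f$ is truthful if $f(x)\ge f(x')$ for all $x,x'\in\mathcal{X}$ with $x\to x'$. For $F'\subseteq F$, a classifier $f$ is an $F'$-classifier if for all $x\in\mathcal{X}$ we have $f(x)=f(x|_{F'})$, and whenever there exists $i\in F'$ with $x_i=*$, then $f(x)=0$. For a (nonempty) collection of classifiers $\mathcal{C}=\{f_j\}$, its Max Ensemble is the classifier $\textsc{Max}_{\mathcal{C}}(x)=\max_j f_j(x)$. *)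

theory Defs
  imports Main "HOL-Library.FuncSet"
begin

text \<open>
  A data point is identified with its feature values: \<open>x i = None\<close> encodes \<open>x\<^sub>i = *\<close>, and the
  restriction of \<open>x\<close> to \<open>S\<close> is the library's \<open>x |` S\<close>. The single type \<open>'v\<close> holds the values of
  all features; which values a feature may actually take is governed by the input space.
\<close>

type_synonym 'v point = "nat \<rightharpoonup> 'v"

definition input_space :: "nat \<Rightarrow> 'v point set \<Rightarrow> bool" where
  "input_space k X \<longleftrightarrow>
     (\<forall>x\<in>X. dom x \<subseteq> {1..k}) \<and> (\<forall>x\<in>X. \<forall>S. S \<subseteq> {1..k} \<longrightarrow> x |` S \<in> X)"

definition reduces_to :: "nat \<Rightarrow> 'v point \<Rightarrow> 'v point \<Rightarrow> bool" where
  "reduces_to k x x' \<longleftrightarrow> (\<exists>S. S \<subseteq> {1..k} \<and> x |` S = x')"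

text \<open>Only the values of a classifier on the input space are relevant.\<close>

definition classifier :: "'v point set \<Rightarrow> ('v point \<Rightarrow> nat) \<Rightarrow> bool" where
  "classifier X f \<longleftrightarrow> f \<in> X \<rightarrow> {0, 1}"

definition truthful :: "nat \<Rightarrow> 'v point set \<Rightarrow> ('v point \<Rightarrow> nat) \<Rightarrow> bool" where
  "truthful k X f \<longleftrightarrow> (\<forall>x\<in>X. \<forall>x'\<in>X. reduces_to k x x' \<longrightarrow> f x \<ge> f x')"

definition subset_classifier ::
    "nat \<Rightarrow> 'v point set \<Rightarrow> nat set \<Rightarrow> ('v point \<Rightarrow> nat) \<Rightarrow> bool" where
  "subset_classifier k X F' f \<longleftrightarrow>
     F' \<subseteq> {1..k} \<and> classifier X f \<and>
     (\<forall>x\<in>X. f x = f (x |` F') \<and> ((\<exists>i\<in>F'. x i = None) \<longrightarrow> f x = 0))"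

text \<open>
  The collection may be infinite, but on the input space classifiers only take the values
  \<open>0\<close> and \<open>1\<close>, so for nonempty \<open>C\<close> this is the maximum of a finite nonempty set.
\<close>

definition max_ensemble :: "('v point \<Rightarrow> nat) set \<Rightarrow> 'v point \<Rightarrow> nat" where
  "max_ensemble C x = Max ((\<lambda>g. g x) ` C)"

end

theory Submission imports Defs begin

text \<open>
  A truthful \<open>f\<close> is the maximum over all \<open>S \<subseteq> {1..k}\<close> of the classifiers that see only the features
  in \<open>S\<close>: they report \<open>f (x|\<^sub>S)\<close> when all these features are present and \<open>0\<close> otherwise. Truthfulness
  bounds each of them by \<open>f\<close>, and the one for the set of features of \<open>x\<close> attains \<open>f x\<close>.
  Conversely, a subset classifier accepting \<open>x|\<^sub>S\<close> only looks at features in \<open>S\<close>, so it accepts \<open>x\<close>.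
\<close>

definition project :: "('v point \<Rightarrow> nat) \<Rightarrow> nat set \<Rightarrow> 'v point \<Rightarrow> nat" where
  "project f S x = (if S \<subseteq> dom x then f (x |` S) else 0)"

lemma project_subset_classifier:
  assumes "input_space k X" "classifier X f" "S \<subseteq> {1..k}"
  shows "subset_classifier k X S (project f S)"
proof -
  have "project f S x \<in> {0, 1}" if "x \<in> X" for x
    using assms that by (auto simp: project_def input_space_def classifier_def Pi_iff)
  \<comment> \<open>Restricting to \<open>S\<close> erases no feature of \<open>S\<close>, so the
    presence test has the same outcome, and restricting twice is restricting once.\<close>
  moreover have "project f S x = project f S (x |` S)" for x
    by (auto simp: project_def)
  moreover have "project f S x = 0" if "i \<in> S" "x i = None" for x i
    using that by (auto simp: project_def)
  ultimately show ?thesis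
    using assms(3) by (auto simp: subset_classifier_def classifier_def)
qed

lemma project_le:
  assumes "input_space k X" "truthful k X f" "S \<subseteq> {1..k}" "x \<in> X"
  shows "project f S x \<le> f x"
proof -
  have "x |` S \<in> X" "reduces_to k x (x |` S)"
    using assms by (auto simp: input_space_def reduces_to_def)
  with assms show ?thesis
    by (auto simp: project_def truthful_def)
qed

lemma project_dom: "project f (dom x) x = f x"
proof -
  have "x |` dom x = x"
    by (rule ext) (auto simp: restrict_map_def dom_def)
  then show ?thesis
    by (simp add: project_def)
qed

lemma max_ensemble_project:
  assumes "input_space k X" "truthful k X f" "x \<in> X"
  shows "max_ensemble (project f ` Pow {1..k}) x = f x"
  unfolding max_ensemble_def
proof (rule Max_eqI)
  \<comment> \<open>The maximum is attained at the index \<open>dom x\<close>, where nothing is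
    erased.\<close>
  have "dom x \<in> Pow {1..k}"
    using assms by (auto simp: input_space_def)
  then show "f x \<in> (\<lambda>g. g x) ` project f ` Pow {1..k}"
    by (intro image_eqI) (auto simp: project_dom)
qed (auto simp del: One_nat_def intro: project_le[OF assms(1,2) _ assms(3)])

text \<open>Either the restriction keeps all of \<open>F'\<close>, and \<open>g\<close> sees no
  difference, or it erases a feature of \<open>F'\<close>, which forces the smaller value 0.\<close>

lemma subset_classifier_truthful:
  assumes "subset_classifier k X F' g"
  shows "truthful k X g"
  unfolding truthful_def
proof (intro ballI impI)
  fix x x' assume x: "x \<in> X" "x' \<in> X" and "reduces_to k x x'"
  then obtain S where S: "x' = x |` S"
    by (auto simp: reduces_to_def)
  show "g x' \<le> g x"
  proof (cases "F' \<subseteq> S")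
    case True
    then have "x' |` F' = x |` F'"
      by (simp add: S Int_absorb1)
    moreover have "g x = g (x |` F')" "g x' = g (x' |` F')"
      using assms x unfolding subset_classifier_def by blast+
    ultimately show ?thesis
      by simp
  next
    case False
    then have "\<exists>i\<in>F'. x' i = None"
      by (auto simp: S restrict_map_def)
    then have "g x' = 0"
      using assms x unfolding subset_classifier_def by blast
    then show ?thesis
      by simp
  qed
qed

lemma max_ensemble_truthful:
  assumes "C \<noteq> {}"
    and "\<And>g. g \<in> C \<Longrightarrow> classifier X g" "\<And>g. g \<in> C \<Longrightarrow> truthful k X g"
  shows "truthful k X (max_ensemble C)"
  unfolding truthful_def
proof (intro ballI impI)
  fix x x' assume x: "x \<in> X" "x' \<in> X" and "reduces_to k x x'"
  \<comment> \<open>\<open>C\<close> may be infinite, but \<open>Max\<close> needs a finite set of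
    values; on \<open>X\<close> they lie in \<open>{0, 1}\<close>.\<close>
  have fin: "finite ((\<lambda>g. g y) ` C)" if "y \<in> X" for y
  proof (rule finite_subset)
    have "g y \<in> {0, 1}" if "g \<in> C" for g
      using assms(2)[OF that] \<open>y \<in> X\<close> unfolding classifier_def by (rule funcset_mem)
    then show "(\<lambda>g. g y) ` C \<subseteq> {0, 1}"
      by (rule image_subsetI)
  qed simp
  have "g x' \<le> max_ensemble C x" if "g \<in> C" for g
  proof -
    have "g x' \<le> g x"
      using assms(3)[OF that] x \<open>reduces_to k x x'\<close> by (auto simp: truthful_def)
    also have "\<dots> \<le> max_ensemble C x"
      unfolding max_ensemble_def by (rule Max_ge) (use fin x that in auto)
    finally show ?thesis .
  qed
  \<comment> \<open>Only the left maximum is unfolded: being over a finite nonempty set, it is below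
    any common bound of its members.\<close>
  then show "max_ensemble C x' \<le> max_ensemble C x"
    using assms(1) fin[OF x(2)] by (subst max_ensemble_def) auto
qed

theorem theorem2:
  fixes k :: nat and X :: "'v point set" and f :: "'v point \<Rightarrow> nat"
  assumes "input_space k X"
    and "classifier X f"
  shows "truthful k X f \<longleftrightarrow>
    (\<exists>(C :: ('v point \<Rightarrow> nat) set) (Fs :: ('v point \<Rightarrow> nat) \<Rightarrow> nat set).
       C \<noteq> {} \<and>
       (\<forall>g\<in>C. subset_classifier k X (Fs g) g) \<and>
       (\<forall>x\<in>X. f x = max_ensemble C x))"
proof
  assume "truthful k X f"
  let ?C = "project f ` Pow {1..k}"
  \<comment> \<open>Different \<open>S\<close> may yield the same function, so \<open>S\<close>
    cannot be read off from \<open>g\<close>; a suitable set is chosen for each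
    \<open>g\<close>.\<close>
  have "\<forall>g\<in>?C. \<exists>S. subset_classifier k X S g"
    using project_subset_classifier[OF assms] by blast
  then obtain Fs where "\<forall>g\<in>?C. subset_classifier k X (Fs g) g"
    by (rule bchoice[THEN exE])
  moreover have "\<forall>x\<in>X. f x = max_ensemble ?C x"
    using max_ensemble_project[OF assms(1) \<open>truthful k X f\<close>] by simp
  moreover have "?C \<noteq> {}"
    by blast
  ultimately show "\<exists>C Fs. C \<noteq> {} \<and> (\<forall>g\<in>C. subset_classifier k X (Fs g) g) \<and>
      (\<forall>x\<in>X. f x = max_ensemble C x)"
    by (intro exI conjI)
next
  assume "\<exists>C Fs. C \<noteq> {} \<and> (\<forall>g\<in>C. subset_classifier k X (Fs g) g) \<and>
      (\<forall>x\<in>X. f x = max_ensemble C x)"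
  then obtain C Fs where C: "C \<noteq> {}" "\<And>g. g \<in> C \<Longrightarrow> subset_classifier k X (Fs g) g"
    and f: "\<And>x. x \<in> X \<Longrightarrow> f x = max_ensemble C x"
    by blast
  have "truthful k X (max_ensemble C)"
    using C(1)
  proof (rule max_ensemble_truthful)
    show "classifier X g" if "g \<in> C" for g
      using C(2)[OF that] by (simp add: subset_classifier_def)
    show "truthful k X g" if "g \<in> C" for g
      using C(2)[OF that] by (rule subset_classifier_truthful)
  qed
  \<comment> \<open>Truthfulness depends only on values on \<open>X\<close>, where \<open>f\<close>
    agrees with the ensemble.\<close>
  then show "truthful k X f"
    by (simp add: truthful_def f)
qed

end
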